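(* Let $\gamma$, $\Gamma$, $p$, $F_1$, $f$, $k$, $g_1$, $\Gamma_1$, $g=g_1^{1/k}$ and $m=p/k$ be as described in the context (in particular, the Birkhoff billiard inside $\gamma$ admits a polynomial integral of even degree $2p$). Then there is a constant $c_1$ such that for all $(x,y)\in\Gamma_1$ $$g^3(x,y)\,H(f(x,y))=c_1\,(x^2+y^2)^{3m-3},$$ where $H(f)=f_{xx}f_y^2-2f_{xy}f_xf_y+f_{yy}f_x^2$.
   Context: Setting. Let $\gamma$ be a smooth convex closed curve in the Euclidean plane, with the origin $O$ of coordinates $(x,y)$ inside, bounding $\Omega$. The Birkhoff billiard flow inside $\gamma$ moves a vector $v=(v_x,v_y)$ at $q\in\Omega$ along the straight line in its direction and reflects it at $\gamma$ by $v_+=v_--2n\langle v_-,n\rangle$ ($n$ the unit outward normal). Put $\sigma=xv_y-yv_x$. Assume the flow has a non-zero integral $\Phi(\sigma,v_x,v_y)$ which is a homogeneous polynomial with real coefficients of even degree $2p$ in $(\sigma,v_x,v_y)$ and vanishes on all tangent vectors to $\gamma$ (any non-constant integral polynomial in $v$ on $\{|v|=1\}$ can be replaced by one of this form). The dual curve $\Gamma$ of $\gamma$ is the set of points dual to the tangent lines of $\gamma$, where the line $\{\langle n,X\rangle=s\}$, $|n|=1$, $s>0$, is dual to the point $n/s$. Put $F_1(x,y)=\Phi(1,-y,x)$, a real polynomial of degree $2p$; it vanishes on $\Gamma$, and $G_1=F_1/(x^2+y^2)^p$ is invariant under the Angular billiard map of $\Gamma$. (That map sends a point $A$ outside $\Gamma$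 to the point $B$ obtained as follows: let $T$ be the tangency point of the tangent line from $A$ to $\Gamma$ for which the direction from $A$ to $T$ agrees with the counterclockwise orientation of $\Gamma$; $B$ is the intersection of the line $AT$ with the line through $O$ symmetric to $OA$ with respect to $OT$.) Let $\Gamma$ be contained in $\{f=0\}$, where $f$ is a polynomial with real coefficients, irreducible in $\mathbb{C}[x,y]$, of degree $d$. Write $F_1=f^k g_1$ with $k$ a positive integer and $g_1$ a real polynomial not identically zero on $\Gamma$. Let $\Gamma_1$ be an arc of $\Gamma$ on which $g_1>0$ (replacing $\Phi$ by $-\Phi$ if necessary). Near $\Gamma_1$ put $g=g_1^{1/k}$ (positive root), and let $m=p/k$. *)

theory Defs
  imports "HOL-Analysis.Analysis" "HOL-Computational_Algebra.Computational_Algebra"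
begin

type_synonym plane = "real \<times> real"

text \<open>Bivariate polynomials are polynomials in \<open>y\<close> whose coefficients are polynomials in \<open>x\<close>;
  trivariate polynomials are polynomials in the third variable over the bivariate ones.\<close>

definition poly2 :: "'a::comm_ring_1 poly poly \<Rightarrow> 'a \<Rightarrow> 'a \<Rightarrow> 'a" where
  "poly2 f x y = poly (poly f [:y:]) x"

definition poly3 :: "'a::comm_ring_1 poly poly poly \<Rightarrow> 'a \<Rightarrow> 'a \<Rightarrow> 'a \<Rightarrow> 'a" where
  "poly3 P a b c = poly2 (poly P [:[:c:]:]) a b"

definition homogeneous3 :: "nat \<Rightarrow> 'a::comm_ring_1 poly poly poly \<Rightarrow> bool" where
  "homogeneous3 n P \<longleftrightarrow> (\<forall>i j l. coeff (coeff (coeff P l) j) i \<noteq> 0 \<longrightarrow> i + j + l = n)"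

abbreviation pderiv_x :: "real poly poly \<Rightarrow> real poly poly" where
  "pderiv_x \<equiv> map_poly pderiv"

abbreviation pderiv_y :: "real poly poly \<Rightarrow> real poly poly" where
  "pderiv_y \<equiv> pderiv"

definition H_poly :: "real poly poly \<Rightarrow> real poly poly" where
  "H_poly f = pderiv_x (pderiv_x f) * (pderiv_y f)\<^sup>2
          - 2 * pderiv_y (pderiv_x f) * pderiv_x f * pderiv_y f
          + pderiv_y (pderiv_y f) * (pderiv_x f)\<^sup>2"

lemma poly2_pderiv_y: "((\<lambda>y. poly2 f x y) has_field_derivative poly2 (pderiv_y f) x y) (at y)"
  for f :: "real poly poly"
  unfolding poly2_def
  by (induction f) (auto simp: pderiv_pCons intro!: derivative_eq_intros)

lemma poly2_pderiv_x: "((\<lambda>x. poly2 f x y) has_field_derivative poly2 (pderiv_x f) x y) (at x)"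
  for f :: "real poly poly"
proof -
  have "pderiv (poly f [:y:]) = poly (pderiv_x f) [:y:]"
    by (induction f) (auto simp: map_poly_pCons pderiv_add pderiv_mult pderiv_pCons pderiv_smult)
  then show ?thesis
    unfolding poly2_def by (metis poly_DERIV)
qed

definition smooth :: "(real \<Rightarrow> plane) \<Rightarrow> bool" where
  "smooth c \<longleftrightarrow>
     (\<forall>n. ((\<lambda>h t. vector_derivative h (at t)) ^^ n) c differentiable_on UNIV)"

text \<open>A curve is given by a regular periodic parametrization over the whole line, traversing the
  simple closed curve once per period, in either direction.\<close>

definition smooth_closed_curve :: "(real \<Rightarrow> plane) \<Rightarrow> bool" where
  "smooth_closed_curve c \<longleftrightarrow>
     smooth c \<and> (\<forall>t. vector_derivative c (at t) \<noteq> 0) \<and>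
     (\<exists>L>0. \<forall>s t. c s = c t \<longleftrightarrow> (\<exists>n::int. t = s + of_int n * L))"

definition smooth_convex_closed_curve :: "(real \<Rightarrow> plane) \<Rightarrow> plane set \<Rightarrow> bool" where
  "smooth_convex_closed_curve c \<Omega> \<longleftrightarrow>
     smooth_closed_curve c \<and> open \<Omega> \<and> bounded \<Omega> \<and> convex \<Omega> \<and> frontier \<Omega> = range c"

definition outward_unit_normal :: "(real \<Rightarrow> plane) \<Rightarrow> plane set \<Rightarrow> real \<Rightarrow> plane \<Rightarrow> bool" where
  "outward_unit_normal c \<Omega> t n \<longleftrightarrow>
     norm n = 1 \<and> n \<bullet> vector_derivative c (at t) = 0 \<and> (\<forall>X\<in>\<Omega>. n \<bullet> (X - c t) < 0)"

text \<open>\<open>billiard_orbit c \<Omega> s s'\<close>: the forward billiard trajectory of the vector \<open>s = (q, v)\<close>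
  passes through \<open>s'\<close>. At a collision, the vectors before and after reflection both belong to
  the trajectory.\<close>

inductive billiard_orbit ::
  "(real \<Rightarrow> plane) \<Rightarrow> plane set \<Rightarrow> plane \<times> plane \<Rightarrow> plane \<times> plane \<Rightarrow> bool"
  for c \<Omega> s
where
  start: "billiard_orbit c \<Omega> s s"
| move: "billiard_orbit c \<Omega> s (q, v) \<Longrightarrow> h \<ge> 0 \<Longrightarrow>
    closed_segment q (q + h *\<^sub>R v) \<subseteq> closure \<Omega> \<Longrightarrow>
    billiard_orbit c \<Omega> s (q + h *\<^sub>R v, v)"
| reflect: "billiard_orbit c \<Omega> s (c t, v) \<Longrightarrow> outward_unit_normal c \<Omega> t n \<Longrightarrow> v \<bullet> n > 0 \<Longrightarrow>
    billiard_orbit c \<Omega> s (c t, v - (2 * (v \<bullet> n)) *\<^sub>R n)"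

definition billiard_integral ::
  "(real \<Rightarrow> plane) \<Rightarrow> plane set \<Rightarrow> (plane \<times> plane \<Rightarrow> real) \<Rightarrow> bool" where
  "billiard_integral c \<Omega> F \<longleftrightarrow>
     (\<forall>q\<in>\<Omega>. \<forall>v s'. billiard_orbit c \<Omega> (q, v) s' \<longrightarrow> F s' = F (q, v))"

text \<open>The function \<open>\<Phi>(\<sigma>, v\<^sub>x, v\<^sub>y)\<close> on vectors \<open>v\<close> at \<open>q\<close>, where
  \<open>\<sigma> = x v\<^sub>y - y v\<^sub>x\<close>.\<close>

definition phase_fun :: "real poly poly poly \<Rightarrow> plane \<times> plane \<Rightarrow> real" where
  "phase_fun \<Phi> = (\<lambda>(q, v). poly3 \<Phi> (fst q * snd v - snd q * fst v) (fst v) (snd v))"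

definition tangent_line :: "(real \<Rightarrow> plane) \<Rightarrow> real \<Rightarrow> plane set" where
  "tangent_line c t = range (\<lambda>u. c t + u *\<^sub>R vector_derivative c (at t))"

definition dual_to_line :: "plane set \<Rightarrow> plane \<Rightarrow> bool" where
  "dual_to_line l P \<longleftrightarrow>
     (\<exists>n s. norm n = 1 \<and> s > 0 \<and> l = {X. n \<bullet> X = s} \<and> P = (1 / s) *\<^sub>R n)"

text \<open>Well defined as soon as no tangent line passes through the origin, in particular for
  convex curves around the origin.\<close>

definition dual_point :: "(real \<Rightarrow> plane) \<Rightarrow> real \<Rightarrow> plane" where
  "dual_point c t = (THE P. dual_to_line (tangent_line c t) P)"

definition dual_curve :: "(real \<Rightarrow> plane) \<Rightarrow> plane set" where
  "dual_curve c = range (dual_point c)"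

definition arc_of_dual :: "(real \<Rightarrow> plane) \<Rightarrow> plane set \<Rightarrow> bool" where
  "arc_of_dual c A \<longleftrightarrow> (\<exists>J. is_interval J \<and> A = dual_point c ` J)"

end

theory Submission
  imports Defs
begin

text \<open>Why the theorem holds. Let \<open>D\<close> be the dual curve, parametrized by \<open>t\<close>, and consider along it
the function \<open>W = g ^ 3 * H(f) * (x\<^sup>2 + y\<^sup>2) powr (3 - 3 m)\<close>. The claim is that \<open>W\<close> is constant. It is a
differentiable function of the point \<open>D\<close>, so only its derivative in the direction \<open>E = D'\<close> matters, and
there is nothing to show where \<open>E = 0\<close>.

Reflecting vectors at the point \<open>\<gamma> t\<close> in the tangent of \<open>\<gamma>\<close> is, on the dual side, the angular billiard map on
the line \<open>D + u E\<close>. It is the projective involution that takes \<open>u\<close> to \<open>u' = - u / (1 + 2 u e)\<close> with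
\<open>e = \<langle>E, D\<rangle> / \<langle>D, D\<rangle>\<close>, and invariance of the integral becomes
\<open>F1 (D + u' E) (1 + 2 u e) ^ (2 p) = F1 (D + u E)\<close> (\<open>angular_billiard_law\<close>).

On this line \<open>f\<close> vanishes at least to second order at \<open>u = 0\<close>. Put \<open>F1 = f ^ k * g1\<close> into the law, divide by
\<open>u ^ (2 k)\<close>, and compare the terms of first order in \<open>u\<close>. Where the second derivative of \<open>f\<close> along \<open>E\<close> is
not zero, this gives a linear relation between the logarithmic derivative of that second derivative,
the one of \<open>g1\<close>, and \<open>e\<close> (\<open>third_order_relation_of_projective_reflection\<close>). Since the gradient of \<open>f\<close> is
orthogonal to \<open>E\<close>, the second and third derivatives of \<open>f\<close> along \<open>E\<close> are proportional to \<open>H(f)\<close> and its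
derivative along \<open>E\<close>, with the same factor (\<open>H_poly_along_tangent\<close>). As \<open>2 e\<close> is the logarithmic derivative
of \<open>x\<^sup>2 + y\<^sup>2\<close>, the relation says exactly that the logarithmic derivative of \<open>W\<close> is zero.

This argument works where \<open>H(f)\<close>, or equivalently \<open>W\<close>, is not zero. So \<open>W W' = 0\<close> on the whole arc,
\<open>W\<^sup>2\<close> is constant, and therefore \<open>W\<close> is constant (\<open>constant_if_derivative_zero_off_zeros\<close>).\<close>

section \<open>Polynomials in two and three variables\<close>

lemma poly2_pCons: "poly2 (pCons c f) x y = poly c x + y * poly2 f x y"
  by (simp add: poly2_def)

lemma poly2_0 [simp]: "poly2 0 x y = 0"
  by (simp add: poly2_def)

lemma poly2_add [simp]: "poly2 (f + h) x y = poly2 f x y + poly2 h x y"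
  by (simp add: poly2_def)

lemma poly2_diff [simp]: "poly2 (f - h) x y = poly2 f x y - poly2 h x y"
  for f h :: "'a::comm_ring_1 poly poly"
  by (simp add: poly2_def)

lemma poly2_mult [simp]: "poly2 (f * h) x y = poly2 f x y * poly2 h x y"
  by (simp add: poly2_def)

lemma poly2_smult [simp]: "poly2 (smult c f) x y = poly c x * poly2 f x y"
  by (simp add: poly2_def)

lemma poly2_power [simp]: "poly2 (f ^ n) x y = poly2 f x y ^ n"
  by (simp add: poly2_def poly_power)

lemma poly2_numeral [simp]: "poly2 (numeral n) x y = numeral n"
  by (simp add: poly2_def)

lemma poly2_sum: "poly2 (\<Sum>i\<in>A. F i) x y = (\<Sum>i\<in>A. poly2 (F i) x y)"
  by (simp add: poly2_def poly_sum)

lemma poly3_0 [simp]: "poly3 0 a b d = 0"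
  by (simp add: poly3_def)

lemma poly3_pCons: "poly3 (pCons c P) a b d = poly2 c a b + d * poly3 P a b d"
  by (simp add: poly3_def poly2_pCons)

lemma poly3_altdef:
  "poly3 P a b d = (\<Sum>l\<le>degree P. \<Sum>j\<le>degree (coeff P l). \<Sum>i\<le>degree (coeff (coeff P l) j).
     coeff (coeff (coeff P l) j) i * a ^ i * b ^ j * d ^ l)"
proof -
  have poly2_altdef: "poly2 f a b = (\<Sum>j\<le>degree f. poly (coeff f j) a * b ^ j)" for f :: "'a poly poly"
    by (simp add: poly2_def poly_altdef[of f] poly_sum poly_power)
  have "poly3 P a b d = (\<Sum>l\<le>degree P. poly2 (coeff P l) a b * d ^ l)"
    by (simp add: poly3_def poly_altdef[of P] poly2_sum poly2_pCons)
  then show ?thesis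
    by (simp add: poly2_altdef poly_altdef sum_distrib_right)
qed

text \<open>Scaling a vector scales \<open>\<sigma>\<close> as well, so the values of \<open>\<Phi>\<close> on the vectors along one line are determined by
one of them. Normalizing \<open>\<sigma> = 1\<close> turns a function of \<open>(\<sigma>, v)\<close> into a function on the dual plane.\<close>

lemma homogeneous3_poly3:
  assumes "homogeneous3 n P"
  shows "poly3 P (c * a) (c * b) (c * d) = c ^ n * poly3 P a b d"
proof -
  have monomial: "coeff (coeff (coeff P l) j) i * (c * a) ^ i * (c * b) ^ j * (c * d) ^ l
      = c ^ n * (coeff (coeff (coeff P l) j) i * a ^ i * b ^ j * d ^ l)" for i j l
  proof (cases "coeff (coeff (coeff P l) j) i = 0")
    case False
    then have "n = i + j + l"
      using assms by (auto simp: homogeneous3_def)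
    then show ?thesis
      by (simp add: power_mult_distrib power_add algebra_simps)
  qed simp
  show ?thesis
    by (simp only: poly3_altdef monomial sum_distrib_left)
qed

lemma pderiv_x_pCons: "pderiv_x (pCons c f) = pCons (pderiv c) (pderiv_x f)"
  by (simp add: map_poly_pCons)

lemma pderiv_x_pderiv_y_commute: "pderiv_x (pderiv_y f) = pderiv_y (pderiv_x f)"
proof (rule poly_eqI)
  fix n
  have "pderiv (of_nat (Suc n) * c) = of_nat (Suc n) * pderiv c" for c :: "real poly"
    by (simp add: pderiv_mult del: of_nat_Suc)
  then show "coeff (pderiv_x (pderiv_y f)) n = coeff (pderiv_y (pderiv_x f)) n"
    by (simp add: coeff_map_poly coeff_pderiv del: of_nat_Suc)
qed

lemma DERIV_poly2_chain:
  assumes "(a has_field_derivative a') (at t within S)" and "(b has_field_derivative b') (at t within S)"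
  shows "((\<lambda>t. poly2 f (a t) (b t)) has_field_derivative
     poly2 (pderiv_x f) (a t) (b t) * a' + poly2 (pderiv_y f) (a t) (b t) * b') (at t within S)"
proof (induction f)
  case 0
  show ?case by simp
next
  case (pCons c f)
  have "((\<lambda>t. poly c (a t)) has_field_derivative poly (pderiv c) (a t) * a') (at t within S)"
    using DERIV_chain2[OF poly_DERIV assms(1)] .
  from DERIV_add[OF this DERIV_mult[OF assms(2) pCons.IH]] show ?case
    by (simp add: poly2_pCons pderiv_x_pCons pderiv_pCons algebra_simps)
qed

text \<open>Restricted to a line, everything becomes a polynomial in one real parameter. For \<open>\<Phi>\<close> this
extends an identity from an open set of vectors to all of them; for \<open>f\<close> and \<open>g1\<close> it gives the Taylor
expansions along a tangent line of the dual curve.\<close>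

lemma poly2_on_line:
  "\<exists>q. \<forall>u. poly2 f (a + u * a') (b + u * b') = poly q (u::real)"
proof (induction f)
  case 0
  show ?case by (auto intro: exI[of _ 0])
next
  case (pCons c f)
  then obtain q where "\<forall>u. poly2 f (a + u * a') (b + u * b') = poly q u" by blast
  then have "\<forall>u. poly2 (pCons c f) (a + u * a') (b + u * b')
      = poly (pcompose c [:a, a':] + [:b, b':] * q) u"
    by (simp add: poly2_pCons poly_pcompose algebra_simps)
  then show ?case by blast
qed

lemma poly3_on_line:
  "\<exists>q. \<forall>u. poly3 P (a + u * a') (b + u * b') (d + u * d') = poly q (u::real)"
proof (induction P)
  case 0
  show ?case by (auto intro: exI[of _ 0])
next
  case (pCons c P)
  then obtain q where "\<forall>u. poly3 P (a + u * a') (b + u * b') (d + u * d') = poly q u" by blast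
  moreover obtain r where "\<forall>u. poly2 c (a + u * a') (b + u * b') = poly r u"
    using poly2_on_line by blast
  ultimately have "\<forall>u. poly3 (pCons c P) (a + u * a') (b + u * b') (d + u * d')
      = poly (r + [:d, d':] * q) u"
    by (simp add: poly3_pCons algebra_simps)
  then show ?case by blast
qed

section \<open>Directional derivatives and the operator H\<close>

lemma pderiv_x_add: "pderiv_x (f + h) = pderiv_x f + pderiv_x h"
  by (rule poly_eqI) (simp add: coeff_map_poly pderiv_add)

lemma pderiv_x_diff: "pderiv_x (f - h) = pderiv_x f - pderiv_x h"
  by (rule poly_eqI) (simp add: coeff_map_poly pderiv_diff)

lemma pderiv_x_smult: "pderiv_x (smult c f) = smult (pderiv c) f + smult c (pderiv_x f)"
  by (rule poly_eqI) (simp add: coeff_map_poly pderiv_mult algebra_simps)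

lemma pderiv_x_mult: "pderiv_x (f * h) = f * pderiv_x h + h * pderiv_x f"
proof (induction f)
  case 0
  show ?case by simp
next
  case (pCons c f)
  then show ?case
    by (simp add: pderiv_x_pCons pderiv_x_add pderiv_x_smult algebra_simps)
qed

lemma pderiv_x_power2: "pderiv_x (f\<^sup>2) = 2 * f * pderiv_x f"
  by (simp add: power2_eq_square pderiv_x_mult algebra_simps)

lemma pderiv_x_numeral: "pderiv_x (numeral n) = 0"
  by (simp add: numeral_poly map_poly_pCons)

lemma pderiv_y_power2: "pderiv_y (f\<^sup>2) = 2 * f * pderiv_y f"
  by (simp add: power2_eq_square pderiv_mult algebra_simps)

lemma pderiv_y_numeral: "pderiv_y (numeral n) = 0"
  by (simp add: numeral_poly)

definition dir_deriv :: "real \<Rightarrow> real \<Rightarrow> real poly poly \<Rightarrow> real poly poly" where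
  "dir_deriv x' y' f = smult [:x':] (pderiv_x f) + smult [:y':] (pderiv_y f)"

lemma poly2_dir_deriv:
  "poly2 (dir_deriv x' y' f) a b = poly2 (pderiv_x f) a b * x' + poly2 (pderiv_y f) a b * y'"
  by (simp add: dir_deriv_def)

lemma dir_deriv_on_line:
  assumes "\<And>u. poly2 f (a + u * a') (b + u * b') = poly q u"
  shows "poly2 (dir_deriv a' b' f) (a + u * a') (b + u * b') = poly (pderiv q) u"
proof -
  have "((\<lambda>u. a + u * a') has_field_derivative a') (at u)"
    "((\<lambda>u. b + u * b') has_field_derivative b') (at u)"
    by (auto intro!: derivative_eq_intros)
  from DERIV_poly2_chain[OF this, of f] show ?thesis
    unfolding assms poly2_dir_deriv using poly_DERIV DERIV_unique by blast
qed

text \<open>Where \<open>f\<close> has zero derivative in a direction, its gradient is \<open>\<mu>\<close> times that direction turned by a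
right angle, so \<open>H f\<close> is \<open>\<mu>\<^sup>2\<close> times the second derivative of \<open>f\<close> in the direction. The derivative of
\<open>H f\<close> contains second derivatives of \<open>f\<close> multiplied by mixed ones, but these cancel, and only the
third derivative in the same direction is left. So along a tangent line \<open>H f\<close> changes to first order as
the second derivative of \<open>f\<close> does.\<close>

lemma H_poly_along_tangent:
  assumes tangent: "poly2 (dir_deriv x' y' f) a b = 0" and nz: "x' \<noteq> 0 \<or> y' \<noteq> 0"
  obtains \<mu> where "poly2 (H_poly f) a b = \<mu>\<^sup>2 * poly2 (dir_deriv x' y' (dir_deriv x' y' f)) a b"
    and "poly2 (dir_deriv x' y' (H_poly f)) a b
       = \<mu>\<^sup>2 * poly2 (dir_deriv x' y' (dir_deriv x' y' (dir_deriv x' y' f))) a b"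
proof -
  \<comment> \<open>One of the two quotients makes sense, and it gives the factor for both partial derivatives.\<close>
  define \<mu> where "\<mu> = (if y' \<noteq> 0 then poly2 (pderiv_x f) a b / y' else - poly2 (pderiv_y f) a b / x')"
  have fx: "poly2 (pderiv_x f) a b = \<mu> * y'" and fy: "poly2 (pderiv_y f) a b = - \<mu> * x'"
    using tangent nz unfolding poly2_dir_deriv by (auto simp: \<mu>_def field_simps split: if_splits)
  note derivs = pderiv_x_add pderiv_x_diff pderiv_x_smult pderiv_x_mult pderiv_x_power2 pderiv_x_numeral
    pderiv_add pderiv_diff pderiv_smult pderiv_mult pderiv_y_power2 pderiv_y_numeral
    pderiv_x_pderiv_y_commute
  show thesis
  proof
    show "poly2 (H_poly f) a b = \<mu>\<^sup>2 * poly2 (dir_deriv x' y' (dir_deriv x' y' f)) a b"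
      by (simp add: H_poly_def dir_deriv_def derivs fx fy pderiv_pCons) algebra
    show "poly2 (dir_deriv x' y' (H_poly f)) a b
       = \<mu>\<^sup>2 * poly2 (dir_deriv x' y' (dir_deriv x' y' (dir_deriv x' y' f))) a b"
      by (simp add: H_poly_def dir_deriv_def derivs fx fy pderiv_pCons) algebra
  qed
qed

section \<open>The integral at a reflection\<close>

definition cross2 :: "plane \<Rightarrow> plane \<Rightarrow> real" where
  "cross2 u v = fst u * snd v - snd u * fst v"

text \<open>A supporting line of the convex region at \<open>c t\<close> has to be the tangent line, because the curve stays on one
side of it.\<close>

lemma outward_unit_normal_exists:
  assumes curve: "smooth_convex_closed_curve c \<Omega>"
  obtains n where "outward_unit_normal c \<Omega> t n"
proof -
  have \<Omega>: "open \<Omega>" "convex \<Omega>" and fr: "frontier \<Omega> = range c"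
    and c: "smooth_closed_curve c"
    using curve by (auto simp: smooth_convex_closed_curve_def)
  have c_closure: "c s \<in> closure \<Omega>" for s
    using fr by (auto simp: frontier_def)
  have "c t \<notin> rel_interior \<Omega>"
    using fr \<Omega> by (auto simp: frontier_def rel_interior_open interior_open)
  then obtain a where a: "a \<noteq> 0" "\<And>y. y \<in> closure \<Omega> \<Longrightarrow> a \<bullet> c t \<le> a \<bullet> y"
      "\<And>y. y \<in> rel_interior \<Omega> \<Longrightarrow> a \<bullet> c t < a \<bullet> y"
    using supporting_hyperplane_relative_frontier[OF \<Omega>(2) c_closure] by metis
  have "c differentiable (at t)"
    using c unfolding smooth_closed_curve_def smooth_def
    by (metis UNIV_I differentiable_on_def funpow_0)
  then have "(c has_derivative (\<lambda>h. h *\<^sub>R vector_derivative c (at t))) (at t)"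
    by (simp add: vector_derivative_works has_vector_derivative_def)
  then have "((\<lambda>s. a \<bullet> c s) has_derivative (\<lambda>h. a \<bullet> (h *\<^sub>R vector_derivative c (at t)))) (at t)"
    by (rule has_derivative_inner_right)
  then have "((\<lambda>s. a \<bullet> c s) has_real_derivative a \<bullet> vector_derivative c (at t)) (at t)"
    by (simp add: has_field_derivative_def mult_commute_abs)
  then have tangent: "a \<bullet> vector_derivative c (at t) = 0"
    by (rule DERIV_local_min[of _ _ _ 1]) (use a(2) c_closure in auto)
  have "outward_unit_normal c \<Omega> t (- (1 / norm a) *\<^sub>R a)"
    unfolding outward_unit_normal_def
  proof (intro conjI ballI)
    fix X assume "X \<in> \<Omega>"
    then have "a \<bullet> c t < a \<bullet> X"
      using a(3) \<Omega> by (simp add: rel_interior_open)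
    then show "(- (1 / norm a) *\<^sub>R a) \<bullet> (X - c t) < 0"
      using a(1) by (simp add: inner_diff_right field_simps)
  qed (use a(1) tangent in simp_all)
  then show thesis using that by blast
qed

text \<open>A vector ending its unit step at \<open>c t\<close> comes from a point of \<open>\<Omega>\<close>; its orbit contains the vector just
before the collision and the reflected one.\<close>

lemma billiard_integral_reflection_inward:
  assumes integral: "billiard_integral c \<Omega> F"
    and \<Omega>: "open \<Omega>" "convex \<Omega>" "c t \<in> closure \<Omega>"
    and n: "outward_unit_normal c \<Omega> t n" and start: "c t - v \<in> \<Omega>"
  shows "F (c t, v - (2 * (v \<bullet> n)) *\<^sub>R n) = F (c t, v)"
proof -
  let ?q = "c t - v"
  have "closed_segment ?q (?q + 1 *\<^sub>R v) \<subseteq> closure \<Omega>"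
    using \<Omega> start closure_subset[of \<Omega>] by (intro closed_segment_subset convex_closure) auto
  from billiard_orbit.move[OF billiard_orbit.start _ this, of c]
  have hit: "billiard_orbit c \<Omega> (?q, v) (c t, v)" by simp
  have "v \<bullet> n > 0"
    using n start by (auto simp: outward_unit_normal_def inner_commute)
  from billiard_orbit.reflect[OF hit n this] hit show ?thesis
    using integral start by (metis billiard_integral_def)
qed

lemma phase_fun_on_line:
  "\<exists>q. \<forall>u. phase_fun \<Phi> (Q, x + u *\<^sub>R y) = poly q u"
proof -
  obtain q where q: "poly3 \<Phi> (cross2 Q x + u * cross2 Q y) (fst x + u * fst y) (snd x + u * snd y)
      = poly q u" for u
    using poly3_on_line by metis
  have "phase_fun \<Phi> (Q, x + u *\<^sub>R y) = poly q u" for u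
    using q[of u] by (simp add: phase_fun_def cross2_def algebra_simps)
  then show ?thesis by blast
qed

text \<open>Billiard orbits give invariance under reflection only for vectors that point out of \<open>\<Omega>\<close>. These form an
open set, and both sides are polynomial along every line through a vector of this set, so the
invariance holds for all vectors, also for those near the tangent direction, which are the ones
needed on the dual side.\<close>

lemma phase_fun_reflection:
  assumes curve: "smooth_convex_closed_curve c \<Omega>" and "\<Omega> \<noteq> {}"
    and integral: "billiard_integral c \<Omega> (phase_fun \<Phi>)"
    and n: "outward_unit_normal c \<Omega> t n"
  shows "phase_fun \<Phi> (c t, v - (2 * (v \<bullet> n)) *\<^sub>R n) = phase_fun \<Phi> (c t, v)"
proof -
  have \<Omega>: "open \<Omega>" "convex \<Omega>" "c t \<in> closure \<Omega>"
    using curve by (auto simp: smooth_convex_closed_curve_def frontier_def)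
  define R where "R = (\<lambda>v. v - (2 * (v \<bullet> n)) *\<^sub>R n)"
  obtain q where "q \<in> \<Omega>" using \<open>\<Omega> \<noteq> {}\<close> by blast
  define v0 where "v0 = c t - q"
  define w where "w = (\<lambda>u. v0 + u *\<^sub>R (v - v0))"
  define U where "U = (\<lambda>u. c t - w u) -` \<Omega>"
  have "open U"
    unfolding U_def w_def by (intro open_vimage \<Omega> continuous_intros)
  moreover have "0 \<in> U"
    using \<open>q \<in> \<Omega>\<close> by (simp add: U_def w_def v0_def)
  ultimately have "infinite U"
    using finite_imp_not_open by blast
  obtain q1 where q1: "phase_fun \<Phi> (c t, w u) = poly q1 u" for u
    using phase_fun_on_line unfolding w_def by metis
  have R_line: "R (w u) = R v0 + u *\<^sub>R R (v - v0)" for u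
    by (simp add: R_def w_def inner_add_left algebra_simps)
  obtain q2 where q2: "phase_fun \<Phi> (c t, R (w u)) = poly q2 u" for u
    using phase_fun_on_line unfolding R_line by metis
  have "U \<subseteq> {u. poly (q2 - q1) u = 0}"
  proof
    fix u assume "u \<in> U"
    then have "c t - w u \<in> \<Omega>" by (simp add: U_def)
    from billiard_integral_reflection_inward[OF integral \<Omega> n this]
    show "u \<in> {u. poly (q2 - q1) u = 0}"
      by (simp add: R_def flip: q1 q2)
  qed
  with \<open>infinite U\<close> have "q2 - q1 = 0"
    using poly_roots_finite finite_subset by blast
  with q1[of 1] q2[of 1] show ?thesis
    by (simp add: w_def R_def)
qed

section \<open>The dual curve\<close>

lemma dual_to_line_incident:
  assumes "dual_to_line l P" and "X \<in> l"
  shows "P \<bullet> X = 1"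
proof -
  obtain n s where "s > 0" "l = {X. n \<bullet> X = s}" "P = (1 / s) *\<^sub>R n"
    using assms(1) unfolding dual_to_line_def by blast
  then show ?thesis
    using assms(2) by (simp only: inner_scaleR_left mem_Collect_eq) simp
qed

text \<open>Incidence with two points of the tangent line forces the coordinates of the dual point. The formula
by Cramer's rule shows that it depends smoothly on \<open>t\<close>; the one with the normal relates it to the
reflection law.\<close>

lemma dual_point_eq:
  assumes n: "norm n = 1" "n \<bullet> vector_derivative c (at t) = 0" and s: "n \<bullet> c t > 0"
    and reg: "vector_derivative c (at t) \<noteq> 0"
  defines "\<delta> \<equiv> cross2 (c t) (vector_derivative c (at t))"
  shows "\<delta> \<noteq> 0"
    and "dual_point c t = (snd (vector_derivative c (at t)) / \<delta>, - fst (vector_derivative c (at t)) / \<delta>)"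
    and "dual_point c t = (1 / (n \<bullet> c t)) *\<^sub>R n"
proof -
  obtain a b where ct: "c t = (a, b)" by fastforce
  obtain a' b' where v: "vector_derivative c (at t) = (a', b')" by fastforce
  obtain n1 n2 where nn: "n = (n1, n2)" by fastforce
  have nv: "n1 * a' + n2 * b' = 0" and nc: "n1 * a + n2 * b > 0" and v0: "a' \<noteq> 0 \<or> b' \<noteq> 0"
    using n s reg by (simp_all add: v nn ct zero_prod_def)
  have \<delta>: "\<delta> = a * b' - b * a'" by (simp add: \<delta>_def cross2_def v ct)
  show \<delta>0: "\<delta> \<noteq> 0"
  proof
    assume "\<delta> = 0"
    then have "a' * (n1 * a + n2 * b) = 0" "b' * (n1 * a + n2 * b) = 0"
      using nv unfolding \<delta> by algebra+
    then show False using nc v0 by simp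
  qed
  have "(X \<in> tangent_line c t) = (n \<bullet> X = n \<bullet> c t)" for X
  proof
    assume "n \<bullet> X = n \<bullet> c t"
    obtain x y where X: "X = (x, y)" by fastforce
    have eq: "n1 * (x - a) + n2 * (y - b) = 0"
      using \<open>n \<bullet> X = n \<bullet> c t\<close> by (simp add: X nn ct algebra_simps)
    have n0: "n1 \<noteq> 0 \<or> n2 \<noteq> 0" using nc by auto
    have par: "(x - a) * b' = (y - b) * a'"
    proof -
      have "n1 * ((x - a) * b' - (y - b) * a') = 0" "n2 * ((x - a) * b' - (y - b) * a') = 0"
        using eq nv by algebra+
      then show ?thesis using n0 by auto
    qed
    define u where "u = (if a' \<noteq> 0 then (x - a) / a' else (y - b) / b')"
    have "x = a + u * a'" "y = b + u * b'"
      using v0 par by (auto simp: u_def field_simps split: if_splits)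
    then show "X \<in> tangent_line c t"
      by (auto simp: tangent_line_def X ct v)
  qed (use n in \<open>auto simp: tangent_line_def inner_add_right\<close>)
  then have line: "tangent_line c t = {X. n \<bullet> X = n \<bullet> c t}" by blast
  have dual: "dual_to_line (tangent_line c t) ((1 / (n \<bullet> c t)) *\<^sub>R n)"
    unfolding dual_to_line_def using n(1) s line by blast
  have unique: "P = (b' / \<delta>, - a' / \<delta>)" if "dual_to_line (tangent_line c t) P" for P
  proof -
    obtain p1 p2 where P: "P = (p1, p2)" by fastforce
    have "c t \<in> tangent_line c t" "c t + vector_derivative c (at t) \<in> tangent_line c t"
      unfolding tangent_line_def by (auto intro: range_eqI[of _ _ 0] range_eqI[of _ _ 1])
    from this[THEN dual_to_line_incident[OF that]]
    have "p1 * a + p2 * b = 1" "p1 * a' + p2 * b' = 0"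
      by (simp_all add: P ct v algebra_simps)
    then have "p1 * \<delta> = b'" "p2 * \<delta> = - a'"
      unfolding \<delta> by algebra+
    then show ?thesis using \<delta>0 by (simp add: P field_simps)
  qed
  have "dual_point c t = (1 / (n \<bullet> c t)) *\<^sub>R n"
    unfolding dual_point_def using dual unique by (metis the_equality)
  moreover have "(1 / (n \<bullet> c t)) *\<^sub>R n = (b' / \<delta>, - a' / \<delta>)"
    using unique[OF dual] .
  ultimately show "dual_point c t = (1 / (n \<bullet> c t)) *\<^sub>R n"
    and "dual_point c t = (snd (vector_derivative c (at t)) / \<delta>, - fst (vector_derivative c (at t)) / \<delta>)"
    by (simp_all add: v)
qed

lemma outward_normal_dual:
  assumes curve: "smooth_convex_closed_curve c \<Omega>" and origin: "(0, 0) \<in> \<Omega>"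
  obtains n where "outward_unit_normal c \<Omega> t n" and "n \<bullet> c t > 0"
    and "dual_point c t = (1 / (n \<bullet> c t)) *\<^sub>R n"
    and "cross2 (c t) (vector_derivative c (at t)) \<noteq> 0"
    and "dual_point c t = (snd (vector_derivative c (at t)) / cross2 (c t) (vector_derivative c (at t)),
          - fst (vector_derivative c (at t)) / cross2 (c t) (vector_derivative c (at t)))"
proof -
  obtain n where n: "outward_unit_normal c \<Omega> t n"
    using outward_unit_normal_exists[OF curve] .
  have "n \<bullet> ((0, 0) - c t) < 0"
    using n origin unfolding outward_unit_normal_def by blast
  then have pos: "n \<bullet> c t > 0"
    by (simp add: inner_diff_right flip: zero_prod_def)
  have reg: "vector_derivative c (at t) \<noteq> 0"
    using curve by (auto simp: smooth_convex_closed_curve_def smooth_closed_curve_def)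
  show thesis
    using that[OF n pos] dual_point_eq[of n c t] n pos reg by (simp add: outward_unit_normal_def)
qed

lemma dual_point_incident:
  assumes "smooth_convex_closed_curve c \<Omega>" and "(0, 0) \<in> \<Omega>"
  shows "fst (dual_point c t) * fst (c t) + snd (dual_point c t) * snd (c t) = 1"
proof -
  obtain n where "n \<bullet> c t > 0" "dual_point c t = (1 / (n \<bullet> c t)) *\<^sub>R n"
    using outward_normal_dual[OF assms] by blast
  then have "dual_point c t \<bullet> c t = 1" by simp
  then show ?thesis by (simp add: inner_prod_def)
qed

text \<open>Differentiating the incidence relation \<open>\<langle>D, c\<rangle> = 1\<close> and using \<open>\<langle>D, c'\<rangle> = 0\<close> shows that the velocity of
the dual curve is orthogonal to \<open>c t\<close>. It is zero where the curvature of \<open>c\<close> vanishes.\<close>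

lemma dual_point_derivative:
  assumes curve: "smooth_convex_closed_curve c \<Omega>" and origin: "(0, 0) \<in> \<Omega>"
  obtains x' y' where "((\<lambda>t. fst (dual_point c t)) has_field_derivative x') (at t)"
    and "((\<lambda>t. snd (dual_point c t)) has_field_derivative y') (at t)"
    and "x' * fst (c t) + y' * snd (c t) = 0"
proof -
  define v where "v = (\<lambda>t. vector_derivative c (at t))"
  have smooth: "smooth c"
    using curve by (auto simp: smooth_convex_closed_curve_def smooth_closed_curve_def)
  have "c differentiable (at t)"
    using smooth[unfolded smooth_def, rule_format, of 0] by (simp add: differentiable_on_def)
  then have "(c has_vector_derivative v t) (at t)"
    by (simp add: vector_derivative_works v_def)
  then have c': "((\<lambda>t. fst (c t)) has_field_derivative fst (v t)) (at t)"
      "((\<lambda>t. snd (c t)) has_field_derivative snd (v t)) (at t)"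
    by (auto simp: has_real_derivative_iff_has_vector_derivative has_vector_derivative_def
        dest: has_derivative_fst has_derivative_snd)
  have "v differentiable (at t)"
    using smooth[unfolded smooth_def, rule_format, of 1] by (simp add: differentiable_on_def v_def)
  then obtain w where "(v has_vector_derivative w) (at t)"
    using vector_derivative_works by blast
  then have v': "((\<lambda>t. fst (v t)) has_field_derivative fst w) (at t)"
      "((\<lambda>t. snd (v t)) has_field_derivative snd w) (at t)"
    by (auto simp: has_real_derivative_iff_has_vector_derivative has_vector_derivative_def
        dest: has_derivative_fst has_derivative_snd)
  have \<delta>: "cross2 (c t) (v t) \<noteq> 0" and D: "dual_point c t = (snd (v t) / cross2 (c t) (v t), - fst (v t) / cross2 (c t) (v t))" for t
    using outward_normal_dual[OF assms, of t] unfolding v_def by metis+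
  have \<delta>': "\<exists>d. ((\<lambda>t. cross2 (c t) (v t)) has_field_derivative d) (at t)"
    unfolding cross2_def
    using DERIV_diff[OF DERIV_mult[OF c'(1) v'(2)] DERIV_mult[OF c'(2) v'(1)]] by blast
  then obtain d where d: "((\<lambda>t. cross2 (c t) (v t)) has_field_derivative d) (at t)" ..
  obtain x' y' where x': "((\<lambda>t. fst (dual_point c t)) has_field_derivative x') (at t)"
    and y': "((\<lambda>t. snd (dual_point c t)) has_field_derivative y') (at t)"
    unfolding D fst_conv snd_conv
    using DERIV_divide[OF v'(2) d \<delta>] DERIV_divide[OF DERIV_minus[OF v'(1)] d \<delta>] by blast
  have "((\<lambda>t. fst (dual_point c t) * fst (c t) + snd (dual_point c t) * snd (c t)) has_field_derivative
      (x' * fst (c t) + fst (v t) * fst (dual_point c t)) + (y' * snd (c t) + snd (v t) * snd (dual_point c t))) (at t)"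
    by (intro DERIV_add DERIV_mult x' y' c')
  moreover have "fst (v t) * fst (dual_point c t) + snd (v t) * snd (dual_point c t) = 0"
    by (simp add: D)
  ultimately have "((\<lambda>t. 1) has_field_derivative x' * fst (c t) + y' * snd (c t)) (at t)"
    unfolding dual_point_incident[OF assms] by (simp add: add_ac)
  then have "x' * fst (c t) + y' * snd (c t) = 0"
    using DERIV_unique DERIV_const by blast
  with x' y' that show thesis by blast
qed

lemma phase_fun_reflection_dual_point:
  assumes curve: "smooth_convex_closed_curve c \<Omega>" and origin: "(0, 0) \<in> \<Omega>"
    and integral: "billiard_integral c \<Omega> (phase_fun \<Phi>)"
    and D: "dual_point c t = (x, y)"
  shows "phase_fun \<Phi> (c t, v - (2 * (v \<bullet> (x, y)) / (x\<^sup>2 + y\<^sup>2)) *\<^sub>R (x, y)) = phase_fun \<Phi> (c t, v)"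
proof -
  obtain n where n: "outward_unit_normal c \<Omega> t n"
    and n_pos: "n \<bullet> c t > 0" and Dn: "dual_point c t = (1 / (n \<bullet> c t)) *\<^sub>R n"
    using outward_normal_dual[OF curve origin] by blast
  have nD: "n = (n \<bullet> c t) *\<^sub>R (x, y)"
    using Dn n_pos by (simp flip: D)
  have "(x, y) \<bullet> (x, y) = 1 / (n \<bullet> c t)\<^sup>2"
    using n unfolding D[symmetric] Dn
    by (simp add: outward_unit_normal_def power2_eq_square norm_eq_1)
  then have N: "x\<^sup>2 + y\<^sup>2 = 1 / (n \<bullet> c t)\<^sup>2"
    by (simp add: power2_eq_square)
  have "(2 * (v \<bullet> n)) *\<^sub>R n = (2 * (v \<bullet> (x, y)) / (x\<^sup>2 + y\<^sup>2)) *\<^sub>R (x, y)"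
    by (subst (1 2) nD) (simp only: N inner_scaleR_right scaleR_scaleR, simp add: power2_eq_square mult_ac)
  with phase_fun_reflection[OF curve _ integral n, of v] origin show ?thesis
    by (metis empty_iff)
qed

section \<open>The angular billiard law on a tangent line of the dual curve\<close>

text \<open>A point \<open>P\<close> of the tangent line to the dual curve at \<open>D = (x, y)\<close> is dual to a
line through the point \<open>(a, b)\<close> of \<open>\<gamma>\<close>, and the vector \<open>v\<close> obtained from \<open>P\<close> by a right-angle turn
directs that line, with moment \<open>\<sigma> = 1\<close>. Reflecting \<open>v\<close> in the tangent of \<open>\<gamma>\<close> amounts to reflecting \<open>P\<close>
in the line \<open>OD\<close>. The moment then becomes \<open>s = 1 + 2 u e\<close>, and dividing by it gives a point of the same
tangent line: the parameter \<open>u\<close> goes to \<open>- u / s\<close>. By homogeneity \<open>F\<close> is multiplied by \<open>s\<close> to the power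
\<open>-n\<close>.\<close>

lemma angular_billiard_law:
  assumes hom: "homogeneous3 n \<Phi>"
    and F: "\<And>x y. poly2 F x y = poly3 \<Phi> 1 (- y) x"
    and refl: "\<And>v. phase_fun \<Phi> ((a, b), v - (2 * (v \<bullet> (x, y)) / (x\<^sup>2 + y\<^sup>2)) *\<^sub>R (x, y)) = phase_fun \<Phi> ((a, b), v)"
    and dual: "x * a + y * b = 1" and along: "x' * a + y' * b = 0"
    and e: "e = (x' * x + y' * y) / (x\<^sup>2 + y\<^sup>2)" and s: "1 + 2 * u * e \<noteq> 0"
  shows "poly2 F (x + - (u / (1 + 2 * u * e)) * x') (y + - (u / (1 + 2 * u * e)) * y') * (1 + 2 * u * e) ^ n
       = poly2 F (x + u * x') (y + u * y')"
proof -
  define N where "N = x\<^sup>2 + y\<^sup>2"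
  define s where "s = 1 + 2 * u * e"
  define v where "v = (- (y + u * y'), x + u * x')"
  have "N \<noteq> 0" using dual by (auto simp: N_def sum_power2_eq_zero_iff)
  have eN: "e * N = x' * x + y' * y" using e \<open>N \<noteq> 0\<close> by (simp add: N_def)
  have v_D: "v \<bullet> (x, y) = u * (y * x' - x * y')"
    by (simp add: v_def algebra_simps)
  have out: "v - (2 * (v \<bullet> (x, y)) / N) *\<^sub>R (x, y) = (- (s * y - u * y'), s * x - u * x')"
  proof -
    have "(2 * (v \<bullet> (x, y)) / N) * x = - (y + u * y') + (s * y - u * y')"
    proof -
      have "2 * (v \<bullet> (x, y)) * x = (- (y + u * y') + (s * y - u * y')) * N"
        unfolding v_D s_def using eN by (simp add: N_def) algebra
      then show ?thesis using \<open>N \<noteq> 0\<close> by (simp add: field_simps)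
    qed
    moreover have "(2 * (v \<bullet> (x, y)) / N) * y = (x + u * x') - (s * x - u * x')"
    proof -
      have "2 * (v \<bullet> (x, y)) * y = ((x + u * x') - (s * x - u * x')) * N"
        unfolding v_D s_def using eN by (simp add: N_def) algebra
      then show ?thesis using \<open>N \<noteq> 0\<close> by (simp add: field_simps)
    qed
    ultimately show ?thesis by (simp add: v_def)
  qed
  have \<sigma>: "a * (x + u * x') - b * - (y + u * y') = 1"
    using dual along by algebra
  have \<sigma>': "a * (s * x - u * x') + b * (s * y - u * y') = s"
    using dual along by algebra
  have "phase_fun \<Phi> ((a, b), v) = poly3 \<Phi> 1 (- (y + u * y')) (x + u * x')"
    by (simp only: phase_fun_def v_def \<sigma> split fst_conv snd_conv)
  moreover have "phase_fun \<Phi> ((a, b), (- (s * y - u * y'), s * x - u * x'))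
      = poly3 \<Phi> (s * 1) (s * - (y + - (u / s) * y')) (s * (x + - (u / s) * x'))"
    using \<sigma>' assms(7) unfolding s_def[symmetric] by (simp add: phase_fun_def algebra_simps)
  ultimately show ?thesis
    using refl[of v] unfolding N_def[symmetric] out homogeneous3_poly3[OF hom] F
    by (simp add: s_def mult.commute)
qed

text \<open>Let \<open>q\<close> vanish to second order at \<open>0\<close>, and let \<open>q ^ k * \<psi>\<close> follow the angular billiard law under the
projective involution \<open>u \<mapsto> - u / (1 + 2 u e)\<close>. After division by \<open>u ^ (2 k)\<close> the law says something at
\<open>u = 0\<close> too, and its first derivative there is the claim: a relation between the logarithmic
derivatives of \<open>q''\<close> and \<open>\<psi>\<close>. Working with \<open>k\<close>-th powers avoids any choice of sign for the roots.\<close>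

lemma third_order_relation_of_projective_reflection:
  fixes q \<psi> :: "real poly" and e :: real
  assumes q0: "poly q 0 = 0" and q1: "poly (pderiv q) 0 = 0"
    and q2: "poly (pderiv (pderiv q)) 0 \<noteq> 0"
    and inv: "\<And>u. 1 + 2 * u * e \<noteq> 0 \<Longrightarrow>
      poly (q ^ k * \<psi>) (- (u / (1 + 2 * u * e))) * (1 + 2 * u * e) ^ (2 * p) = poly (q ^ k * \<psi>) u"
  shows "real k * poly (pderiv (pderiv (pderiv q))) 0 * poly \<psi> 0
           + 3 * poly (pderiv (pderiv q)) 0 * poly (pderiv \<psi>) 0
         = 6 * e * (real p - real k) * poly (pderiv (pderiv q)) 0 * poly \<psi> 0"
proof -
  \<comment> \<open>Split off the double zero: \<open>q = u\<^sup>2 * r\<close>.\<close>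
  obtain c0 c1 r where "q = pCons c0 (pCons c1 r)"
    by (metis pCons_cases)
  with q0 q1 have q: "q = pCons 0 (pCons 0 r)"
    by (simp add: pderiv_pCons)
  have "pderiv (2 * r) = 2 * pderiv r"
    unfolding mult_2 pderiv_add ..
  then have r0: "poly (pderiv (pderiv q)) 0 = 2 * poly r 0"
    and r1: "poly (pderiv (pderiv (pderiv q))) 0 = 6 * poly (pderiv r) 0"
    by (simp_all add: q pderiv_pCons pderiv_add)
  define B where "B = r ^ k * \<psi>"
  define L where "L = (\<lambda>u. 1 + 2 * u * e)"
  define S where "S = {u. L u \<noteq> 0}"
  have "open S"
    unfolding S_def L_def by (intro open_Collect_neq continuous_intros)
  have B_eq: "poly B (- (u / L u)) * L u ^ (2 * p) - L u ^ (2 * k) * poly B u = 0" if "u \<in> S" for u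
  proof (cases "u = 0")
    case True
    then show ?thesis by (simp add: L_def)
  next
    case False
    have L: "L u \<noteq> 0" using that by (simp add: S_def)
    have split: "poly (q ^ k * \<psi>) z = z ^ (2 * k) * poly B z" for z
      by (simp add: q B_def poly_power power_mult power2_eq_square power_mult_distrib)
    have "(u / L u) ^ (2 * k) * poly B (- (u / L u)) * L u ^ (2 * p) = u ^ (2 * k) * poly B u"
      using inv[of u] L unfolding split L_def by (simp add: mult_ac)
    then have "u ^ (2 * k) * (poly B (- (u / L u)) * L u ^ (2 * p)) = u ^ (2 * k) * (L u ^ (2 * k) * poly B u)"
      using L by (simp add: power_divide field_simps)
    then show ?thesis using False by simp
  qed
  have B': "(poly B has_field_derivative poly (pderiv B) 0) (at (- (0 / L 0)))"
    using poly_DERIV[of B 0] by simp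
  have L': "(L has_field_derivative 2 * e) (at 0)"
    unfolding L_def by (auto intro!: derivative_eq_intros)
  have L_pow: "((\<lambda>u. L u ^ n) has_field_derivative real n * (2 * e)) (at 0)" for n
    using DERIV_power[OF L', of n] by (simp add: L_def)
  have "((\<lambda>u. - (u / L u)) has_field_derivative - 1) (at 0)"
    using DERIV_minus[OF DERIV_divide[OF DERIV_ident L']] by (simp add: L_def)
  from DERIV_chain2[OF B' this]
  have "((\<lambda>u. poly B (- (u / L u))) has_field_derivative - poly (pderiv B) 0) (at 0)"
    by simp
  from DERIV_diff[OF DERIV_mult[OF this L_pow[of "2 * p"]] DERIV_mult[OF L_pow[of "2 * k"] poly_DERIV[of B]]]
  have "((\<lambda>u. poly B (- (u / L u)) * L u ^ (2 * p) - L u ^ (2 * k) * poly B u) has_field_derivative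
      - 2 * poly (pderiv B) 0 + 4 * e * (real p - real k) * poly B 0) (at 0)"
    by (simp add: L_def algebra_simps)
  moreover have "((\<lambda>u. poly B (- (u / L u)) * L u ^ (2 * p) - L u ^ (2 * k) * poly B u)
      has_field_derivative 0) (at 0)"
  proof (rule has_field_derivative_transform_within_open[OF DERIV_const \<open>open S\<close>])
    show "0 \<in> S" by (simp add: S_def L_def)
    show "0 = poly B (- (u / L u)) * L u ^ (2 * p) - L u ^ (2 * k) * poly B u" if "u \<in> S" for u
      using B_eq[OF that] by (rule sym)
  qed
  ultimately have "- 2 * poly (pderiv B) 0 + 4 * e * (real p - real k) * poly B 0 = 0"
    by (rule DERIV_unique)
  then have B1: "poly (pderiv B) 0 = 2 * e * (real p - real k) * poly B 0"
    by linarith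
  have rk: "poly (pderiv (r ^ k)) 0 * poly r 0 = real k * poly r 0 ^ k * poly (pderiv r) 0"
  proof (cases k)
    case (Suc n)
    show ?thesis
      unfolding Suc pderiv_power_Suc by (simp add: poly_power algebra_simps)
  qed simp
  have "poly r 0 ^ k * (real k * poly (pderiv r) 0 * poly \<psi> 0 + poly r 0 * poly (pderiv \<psi>) 0)
      = poly r 0 * poly (pderiv B) 0"
    using rk by (simp add: B_def pderiv_mult poly_power algebra_simps)
  also have "\<dots> = poly r 0 ^ k * (2 * e * (real p - real k) * poly r 0 * poly \<psi> 0)"
    unfolding B1 by (simp add: B_def poly_power)
  finally show ?thesis
    using q2 by (simp add: r0 r1)
qed

text \<open>The univariate relation, carried from the tangent line to the plane: up to the factor \<open>\<mu>\<^sup>2\<close>, the second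
and third derivatives of \<open>f\<close> along the tangent are \<open>H f\<close> and its first derivative.\<close>

lemma log_derivative_relation:
  fixes f h :: "real poly poly"
  assumes on_curve: "poly2 f a b = 0" and tangent: "poly2 (dir_deriv x' y' f) a b = 0"
    and law: "\<And>u. 1 + 2 * u * e \<noteq> 0 \<Longrightarrow>
      poly2 (f ^ k * h) (a + - (u / (1 + 2 * u * e)) * x') (b + - (u / (1 + 2 * u * e)) * y')
        * (1 + 2 * u * e) ^ (2 * p) = poly2 (f ^ k * h) (a + u * x') (b + u * y')"
    and nz: "x' \<noteq> 0 \<or> y' \<noteq> 0" and H: "poly2 (H_poly f) a b \<noteq> 0"
  shows "real k * poly2 (dir_deriv x' y' (H_poly f)) a b * poly2 h a b
           + 3 * poly2 (H_poly f) a b * poly2 (dir_deriv x' y' h) a b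
         = 6 * e * (real p - real k) * poly2 (H_poly f) a b * poly2 h a b"
proof -
  obtain \<mu> where \<mu>: "poly2 (H_poly f) a b = \<mu>\<^sup>2 * poly2 (dir_deriv x' y' (dir_deriv x' y' f)) a b"
      "poly2 (dir_deriv x' y' (H_poly f)) a b
       = \<mu>\<^sup>2 * poly2 (dir_deriv x' y' (dir_deriv x' y' (dir_deriv x' y' f))) a b"
    using H_poly_along_tangent[OF tangent nz] by blast
  obtain q where q: "poly2 f (a + u * x') (b + u * y') = poly q u" for u
    using poly2_on_line by metis
  obtain \<psi> where \<psi>: "poly2 h (a + u * x') (b + u * y') = poly \<psi> u" for u
    using poly2_on_line by metis
  note q1 = dir_deriv_on_line[OF q]
  note q2 = dir_deriv_on_line[OF q1]
  note q3 = dir_deriv_on_line[OF q2]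
  note \<psi>1 = dir_deriv_on_line[OF \<psi>]
  note at0 = q[of 0] q1[of 0] q2[of 0] q3[of 0] \<psi>[of 0] \<psi>1[of 0]
  have "real k * poly (pderiv (pderiv (pderiv q))) 0 * poly \<psi> 0
           + 3 * poly (pderiv (pderiv q)) 0 * poly (pderiv \<psi>) 0
         = 6 * e * (real p - real k) * poly (pderiv (pderiv q)) 0 * poly \<psi> 0"
  proof (rule third_order_relation_of_projective_reflection)
    show "poly q 0 = 0" "poly (pderiv q) 0 = 0"
      using on_curve tangent at0 by simp_all
    show "poly (pderiv (pderiv q)) 0 \<noteq> 0"
      using H \<mu>(1) at0 by auto
    show "poly (q ^ k * \<psi>) (- (u / (1 + 2 * u * e))) * (1 + 2 * u * e) ^ (2 * p) = poly (q ^ k * \<psi>) u"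
      if "1 + 2 * u * e \<noteq> 0" for u
      using law[OF that] unfolding poly2_mult poly2_power q \<psi> by (simp add: poly_power)
  qed
  then show ?thesis
    using at0 \<mu> by simp algebra
qed

section \<open>Constancy along the dual curve\<close>

text \<open>The square of \<open>W\<close> has zero derivative, hence is constant; if this constant is not zero, then \<open>W\<close> has no zeros
and zero derivative itself. The lemma is needed because the relation for the derivative of \<open>H f\<close> is
available only where \<open>H f\<close> does not vanish.\<close>

lemma constant_if_derivative_zero_off_zeros:
  fixes W :: "real \<Rightarrow> real"
  assumes J: "convex J"
    and W': "\<And>t. t \<in> J \<Longrightarrow> \<exists>d. (W has_field_derivative d) (at t within J) \<and> W t * d = 0"
  shows "\<exists>c. \<forall>t\<in>J. W t = c"
proof -
  have "((\<lambda>t. (W t)\<^sup>2) has_field_derivative 0) (at t within J)" if t: "t \<in> J" for t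
  proof -
    obtain d where d: "(W has_field_derivative d) (at t within J)" "W t * d = 0"
      using W'[OF t] by blast
    then have zero: "d * W t + d * W t = 0" by auto
    show ?thesis
      using DERIV_mult[OF d(1) d(1)] unfolding zero power2_eq_square .
  qed
  then obtain C where C: "(W t)\<^sup>2 = C" if "t \<in> J" for t
    using has_field_derivative_zero_constant[OF J, of "\<lambda>t. (W t)\<^sup>2"] by blast
  show ?thesis
  proof (cases "C = 0")
    case True
    then show ?thesis using C by auto
  next
    case False
    have "(W has_field_derivative 0) (at t within J)" if t: "t \<in> J" for t
    proof -
      obtain d where d: "(W has_field_derivative d) (at t within J)" "W t * d = 0"
        using W'[OF t] by blast
      with C[OF t] False show ?thesis by auto
    qed
    then show ?thesis
      using has_field_derivative_zero_constant[OF J] by blast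
  qed
qed

theorem theorem6p1:
  fixes \<gamma> :: "real \<Rightarrow> plane" and \<Omega> \<Gamma>1 :: "plane set" and p k :: nat
    and \<Phi> :: "real poly poly poly" and F1 f g1 :: "real poly poly"
    and g :: "real \<Rightarrow> real \<Rightarrow> real" and m :: real
  assumes curve: "smooth_convex_closed_curve \<gamma> \<Omega>"
    and origin: "(0, 0) \<in> \<Omega>"
    and Phi_nonzero: "\<Phi> \<noteq> 0"
    and Phi_homogeneous: "homogeneous3 (2 * p) \<Phi>"
    and Phi_integral: "billiard_integral \<gamma> \<Omega> (phase_fun \<Phi>)"
    and Phi_tangent: "\<And>t a. phase_fun \<Phi> (\<gamma> t, a *\<^sub>R vector_derivative \<gamma> (at t)) = 0"
    and F1: "\<And>x y. poly2 F1 x y = poly3 \<Phi> 1 (- y) x"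
    and f_irreducible: "irreducible (map_poly (map_poly complex_of_real) f)"
    and f_Gamma: "\<And>x y. (x, y) \<in> dual_curve \<gamma> \<Longrightarrow> poly2 f x y = 0"
    and k_pos: "k > 0"
    and factorization: "F1 = f ^ k * g1"
    and g1_Gamma: "\<exists>(x, y) \<in> dual_curve \<gamma>. poly2 g1 x y \<noteq> 0"
    and Gamma1_arc: "arc_of_dual \<gamma> \<Gamma>1"
    and g1_pos: "\<And>x y. (x, y) \<in> \<Gamma>1 \<Longrightarrow> poly2 g1 x y > 0"
    and g: "\<And>x y. g x y = root k (poly2 g1 x y)"
    and m: "m = real p / real k"
  shows "\<exists>c1. \<forall>(x, y) \<in> \<Gamma>1.
    g x y ^ 3 * poly2 (H_poly f) x y = c1 * (x\<^sup>2 + y\<^sup>2) powr (3 * m - 3)"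
proof -
  obtain J where J: "convex J" and \<Gamma>1: "\<Gamma>1 = dual_point \<gamma> ` J"
    using Gamma1_arc is_interval_convex unfolding arc_of_dual_def by blast
  define X where "X = (\<lambda>t. fst (dual_point \<gamma> t))"
  define Y where "Y = (\<lambda>t. snd (dual_point \<gamma> t))"
  have XY: "dual_point \<gamma> t = (X t, Y t)" for t
    by (simp add: X_def Y_def)
  define N where "N = (\<lambda>t. (X t)\<^sup>2 + (Y t)\<^sup>2)"
  define G where "G = (\<lambda>t. poly2 g1 (X t) (Y t))"
  define h where "h = (\<lambda>t. poly2 (H_poly f) (X t) (Y t))"
  define W where "W = (\<lambda>t. G t powr (3 / k) * h t * N t powr (3 - 3 * m))"
  have G_pos: "G t > 0" if "t \<in> J" for t
    using g1_pos that by (auto simp: G_def \<Gamma>1 XY)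
  have incident: "X t * fst (\<gamma> t) + Y t * snd (\<gamma> t) = 1" for t
    using dual_point_incident[OF curve origin] by (simp add: X_def Y_def)
  have N_pos: "N t > 0" for t
    unfolding N_def using incident[of t] by (auto simp: sum_power2_gt_zero_iff)
  have f0: "poly2 f (X t) (Y t) = 0" for t
    using f_Gamma by (auto simp: dual_curve_def simp flip: XY)

  have W': "\<exists>d. (W has_field_derivative d) (at t) \<and> W t * d = 0" if t: "t \<in> J" for t
  proof -
    obtain x' y' where x': "(X has_field_derivative x') (at t)" and y': "(Y has_field_derivative y') (at t)"
      and along: "x' * fst (\<gamma> t) + y' * snd (\<gamma> t) = 0"
      using dual_point_derivative[OF curve origin] unfolding X_def Y_def by metis
    have chain: "((\<lambda>t. poly2 P (X t) (Y t)) has_field_derivative poly2 (dir_deriv x' y' P) (X t) (Y t)) (at t)" for P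
      unfolding poly2_dir_deriv using DERIV_poly2_chain[OF x' y'] .
    define G' where "G' = poly2 (dir_deriv x' y' g1) (X t) (Y t)"
    define h' where "h' = poly2 (dir_deriv x' y' (H_poly f)) (X t) (Y t)"
    define e where "e = (x' * X t + y' * Y t) / N t"
    have G: "(G has_field_derivative G') (at t)" and H: "(h has_field_derivative h') (at t)"
      unfolding G_def G'_def h_def h'_def using chain by blast+
    have N: "(N has_field_derivative 2 * e * N t) (at t)"
      unfolding N_def using N_pos[of t]
      by (auto intro!: derivative_eq_intros x' y' simp: e_def N_def)
    \<comment> \<open>The velocity of the dual curve is tangent to the level set of \<open>f\<close> containing it.\<close>
    have tangent: "poly2 (dir_deriv x' y' f) (X t) (Y t) = 0"
      using chain[of f] unfolding f0 using DERIV_unique DERIV_const by blast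

    have relation: "real k * h' * G t + 3 * h t * G' = 6 * e * (real p - real k) * h t * G t"
      if nz: "h t \<noteq> 0"
    proof (cases "x' = 0 \<and> y' = 0")
      \<comment> \<open>The dual curve has zero velocity here, so all derivatives along it are zero.\<close>
      case True
      then show ?thesis by (simp add: h'_def G'_def e_def poly2_dir_deriv)
    next
      case False
      have refl: "phase_fun \<Phi> (\<gamma> t, v - (2 * (v \<bullet> (X t, Y t)) / N t) *\<^sub>R (X t, Y t))
          = phase_fun \<Phi> (\<gamma> t, v)" for v
        using phase_fun_reflection_dual_point[OF curve origin Phi_integral XY] by (simp add: N_def)
      show ?thesis
        unfolding h'_def h_def G_def G'_def
      proof (rule log_derivative_relation[OF f0 tangent])
        show "poly2 (f ^ k * g1) (X t + - (u / (1 + 2 * u * e)) * x') (Y t + - (u / (1 + 2 * u * e)) * y')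
            * (1 + 2 * u * e) ^ (2 * p) = poly2 (f ^ k * g1) (X t + u * x') (Y t + u * y')"
          if "1 + 2 * u * e \<noteq> 0" for u
          unfolding factorization[symmetric]
          by (rule angular_billiard_law[OF Phi_homogeneous F1 _ incident along _ that])
            (use refl in \<open>simp_all add: e_def N_def\<close>)
      qed (use False nz in \<open>simp_all add: h_def\<close>)
    qed

    \<comment> \<open>The bracket is \<open>h t\<close> times the logarithmic derivative of \<open>W\<close>, written without dividing by \<open>h t\<close>.\<close>
    define d where "d = G t powr (3 / k) * N t powr (3 - 3 * m) * (3 / k * G' / G t * h t + h' + (3 - 3 * m) * (2 * e) * h t)"
    have Gp: "((\<lambda>t. G t powr (3 / k)) has_field_derivative G t powr (3 / k) * (3 / k * G' / G t)) (at t)"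
      using DERIV_powr[OF G G_pos[OF t] DERIV_const, of "3 / k"] by (simp add: mult_ac)
    have Np: "((\<lambda>t. N t powr (3 - 3 * m)) has_field_derivative
        N t powr (3 - 3 * m) * ((3 - 3 * m) * (2 * e))) (at t)"
      using DERIV_powr[OF N N_pos DERIV_const, of "3 - 3 * m"] N_pos[of t] by (simp add: mult_ac)
    have "(W has_field_derivative d) (at t)"
      using DERIV_mult[OF DERIV_mult[OF Gp H] Np] unfolding W_def d_def by (simp add: algebra_simps)
    moreover have "W t * d = 0"
    proof (cases "h t = 0")
      case True
      then show ?thesis by (simp add: W_def)
    next
      case False
      have "real k * G t * (3 / k * G' / G t * h t + h' + (3 - 3 * m) * (2 * e) * h t)
          = (real k * h' * G t + 3 * h t * G') - 6 * e * (real p - real k) * h t * G t"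
        using k_pos G_pos[OF t] by (simp add: m field_simps)
      also have "\<dots> = 0" using relation[OF False] by simp
      finally show ?thesis
        using k_pos G_pos[OF t] by (simp add: d_def)
    qed
    ultimately show ?thesis by blast
  qed

  obtain c1 where c1: "W t = c1" if "t \<in> J" for t
    using constant_if_derivative_zero_off_zeros[OF J, of W] W' has_field_derivative_at_within by metis
  have "g (X t) (Y t) ^ 3 * poly2 (H_poly f) (X t) (Y t) = c1 * ((X t)\<^sup>2 + (Y t)\<^sup>2) powr (3 * m - 3)"
    if t: "t \<in> J" for t
  proof -
    have "g (X t) (Y t) ^ 3 = (G t powr (1 / k)) ^ 3"
      using k_pos G_pos[OF t] by (simp add: g G_def root_powr_inverse)
    also have "\<dots> = G t powr (3 / k)"
      using G_pos[OF t] by (simp add: powr_power)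
    finally have "g (X t) (Y t) ^ 3 * h t * N t powr (3 - 3 * m) = c1"
      using c1[OF t] by (simp add: W_def)
    then have "c1 * N t powr (3 * m - 3) = g (X t) (Y t) ^ 3 * h t * (N t powr (3 - 3 * m) * N t powr (3 * m - 3))"
      by (simp add: mult_ac)
    also have "N t powr (3 - 3 * m) * N t powr (3 * m - 3) = 1"
      using N_pos[of t] by (simp flip: powr_add)
    finally show ?thesis by (simp add: h_def N_def)
  qed
  then show ?thesis
    unfolding \<Gamma>1 by (auto simp: XY)
qed

end
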